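(* For every integer $n\geq 12$, there exists a 2-connected pseudo-outerplanar graph of order $n$ whose edge set cannot be partitioned into the edge set of an outerplanar graph and a matching.
   Context: All graphs are finite, simple and undirected. A block is a maximal 2-connected subgraph. A graph is pseudo-outerplanar if each of its blocks can be drawn in the plane so that its vertices lie on a fixed circle, its edges lie inside the disk bounded by that circle, and each edge crosses at most one other edge. *)

theory Defs
  imports "HOL-Analysis.Analysis"
begin

record 'a ugraph =
  verts :: "'a set"
  edges :: "'a set set"

definition simple_graph :: "'a ugraph \<Rightarrow> bool" where
  "simple_graph G \<longleftrightarrow>
     finite (verts G) \<and> (\<forall>e\<in>edges G. e \<subseteq> verts G \<and> card e = 2)"

definition subgraph :: "'a ugraph \<Rightarrow> 'a ugraph \<Rightarrow> bool" where
  "subgraph H G \<longleftrightarrow>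
     simple_graph H \<and> simple_graph G \<and> verts H \<subseteq> verts G \<and> edges H \<subseteq> edges G"

definition adj_rel :: "'a ugraph \<Rightarrow> ('a \<times> 'a) set" where
  "adj_rel G = {(u, v). {u, v} \<in> edges G}"

definition connected_graph :: "'a ugraph \<Rightarrow> bool" where
  "connected_graph G \<longleftrightarrow>
     verts G \<noteq> {} \<and> (\<forall>u\<in>verts G. \<forall>v\<in>verts G. (u, v) \<in> (adj_rel G)\<^sup>*)"

definition delete_vertex :: "'a ugraph \<Rightarrow> 'a \<Rightarrow> 'a ugraph" where
  "delete_vertex G v =
     \<lparr>verts = verts G - {v}, edges = {e \<in> edges G. v \<notin> e}\<rparr>"

definition two_connected :: "'a ugraph \<Rightarrow> bool" where
  "two_connected G \<longleftrightarrow>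
     simple_graph G \<and> 3 \<le> card (verts G) \<and> connected_graph G \<and>
     (\<forall>v\<in>verts G. connected_graph (delete_vertex G v))"

text \<open>Under the convention that a 2-connected graph has at least three vertices,
  bridges and isolated vertices are not blocks. Since \<open>K\<^sub>1\<close> and \<open>K\<^sub>2\<close> can
  be drawn without crossings, this does not affect which graphs are
  pseudo-outerplanar.\<close>

definition is_block :: "'a ugraph \<Rightarrow> 'a ugraph \<Rightarrow> bool" where
  "is_block B G \<longleftrightarrow>
     subgraph B G \<and> two_connected B \<and>
     (\<forall>H. subgraph H G \<and> two_connected H \<and> subgraph B H \<longrightarrow> H = B)"

text \<open>In a drawing in the plane \<open>\<complex>\<close>, vertices are distinct points
  and the edge \<open>e\<close> is a simple curve \<open>\<gamma> e\<close> joining its ends and avoiding all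
  other vertices. Edges may meet each other outside the vertices.\<close>

definition drawing :: "'a ugraph \<Rightarrow> ('a \<Rightarrow> complex) \<Rightarrow> ('a set \<Rightarrow> real \<Rightarrow> complex) \<Rightarrow> bool" where
  "drawing G pos \<gamma> \<longleftrightarrow>
     inj_on pos (verts G) \<and>
     (\<forall>e\<in>edges G.
        arc (\<gamma> e) \<and>
        {pathstart (\<gamma> e), pathfinish (\<gamma> e)} = pos ` e \<and>
        path_image (\<gamma> e) \<inter> pos ` verts G = pos ` e)"

text \<open>Two edges cross if they have a common point that is not a vertex. In
  particular, touching counts as crossing, and adjacent edges may cross.\<close>

definition crosses ::
  "'a ugraph \<Rightarrow> ('a \<Rightarrow> complex) \<Rightarrow> ('a set \<Rightarrow> real \<Rightarrow> complex) \<Rightarrow> 'a set \<Rightarrow> 'a set \<Rightarrow> bool" where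
  "crosses G pos \<gamma> e f \<longleftrightarrow>
     e \<noteq> f \<and> path_image (\<gamma> e) \<inter> path_image (\<gamma> f) - pos ` verts G \<noteq> {}"

definition circle_drawing ::
  "'a ugraph \<Rightarrow> ('a \<Rightarrow> complex) \<Rightarrow> ('a set \<Rightarrow> real \<Rightarrow> complex) \<Rightarrow> bool" where
  "circle_drawing G pos \<gamma> \<longleftrightarrow>
     drawing G pos \<gamma> \<and>
     (\<exists>c r. 0 < r \<and> pos ` verts G \<subseteq> sphere c r \<and>
        (\<forall>e\<in>edges G. path_image (\<gamma> e) - pos ` e \<subseteq> ball c r))"

definition pseudo_outerplanar :: "'a ugraph \<Rightarrow> bool" where
  "pseudo_outerplanar G \<longleftrightarrow>
     simple_graph G \<and>
     (\<forall>B. is_block B G \<longrightarrow>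
        (\<exists>pos \<gamma>. circle_drawing B pos \<gamma> \<and>
           (\<forall>e\<in>edges B. card {f \<in> edges B. crosses B pos \<gamma> e f} \<le> 1)))"

definition drawing_image ::
  "'a ugraph \<Rightarrow> ('a \<Rightarrow> complex) \<Rightarrow> ('a set \<Rightarrow> real \<Rightarrow> complex) \<Rightarrow> complex set" where
  "drawing_image G pos \<gamma> = pos ` verts G \<union> (\<Union>e\<in>edges G. path_image (\<gamma> e))"

text \<open>The drawing of a finite graph is compact, so its \<^const>\<open>outside\<close> is the
  unbounded component of the complement, i.e. the outer face.\<close>

definition outerplanar :: "'a ugraph \<Rightarrow> bool" where
  "outerplanar G \<longleftrightarrow>
     simple_graph G \<and>
     (\<exists>pos \<gamma>. drawing G pos \<gamma> \<and>
        (\<forall>e\<in>edges G. \<forall>f\<in>edges G. \<not> crosses G pos \<gamma> e f) \<and>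
        (\<forall>v\<in>verts G. pos v \<in> frontier (outside (drawing_image G pos \<gamma>))))"

definition matching :: "'a set set \<Rightarrow> bool" where
  "matching M \<longleftrightarrow> (\<forall>e\<in>M. \<forall>f\<in>M. e \<noteq> f \<longrightarrow> e \<inter> f = {})"

end

theory Submission
  imports Defs "HOL-Complex_Analysis.Winding_Numbers"
begin

text \<open>Take a \<open>K\<^sub>4\<close> on the hubs \<open>0, 3, 6, 9\<close> and glue a further \<open>K\<^sub>4\<close> onto each side of the
  4-cycle through the hubs. Suppose a matching \<open>M\<close> is removed and an outerplanar graph remains.
  If no edge of \<open>M\<close> joins an end of some side to an outer vertex of its \<open>K\<^sub>4\<close>, then both outer
  vertices together with a path through the other hubs form a subdivided \<open>K\<^sub>2\<^sub>,\<^sub>3\<close>. So each side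
  uses up one of its ends, and hence all four hubs are matched to outer vertices. Then two
  adjacent hubs retain the other two hubs and an outer vertex as common neighbours, which is
  again a \<open>K\<^sub>2\<^sub>,\<^sub>3\<close>.

  A subdivided \<open>K\<^sub>2\<^sub>,\<^sub>3\<close> is not outerplanar because of three arcs with common ends, one always
  lies inside the loop formed by the other two. Larger orders are obtained by adding vertices
  on an outer path.\<close>


section \<open>Three arcs with common ends in the plane\<close>

text \<open>\<open>C\<close> lies in one component of the complement of \<open>S\<close>, and
  \<open>inside S\<close> is a union of such components.\<close>

lemma connected_subset_inside:
  assumes "connected C" "C \<inter> S = {}" "C \<inter> inside S \<noteq> {}"
  shows "C \<subseteq> inside S"
proof
  fix y assume "y \<in> C"
  obtain x where x: "x \<in> C" "x \<in> inside S" using assms(3) by blast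
  have "connected_component (- S) x y"
    unfolding connected_component_def using assms x \<open>y \<in> C\<close> by blast
  with x(2) show "y \<in> inside S" by (meson inside_same_component)
qed

lemma arc_loop:
  assumes "arc c" "arc d" "pathstart c = a" "pathfinish c = b" "pathstart d = a" "pathfinish d = b"
    and "path_image c \<inter> path_image d = {a, b}"
  shows "simple_path (c +++ reversepath d)"
    and "path_image (c +++ reversepath d) = path_image c \<union> path_image d"
    and "pathfinish (c +++ reversepath d) = pathstart (c +++ reversepath d)"
  using assms by (auto simp: simple_path_join_loop_eq arc_reversepath path_image_join)

lemma arc_loop_inside:
  fixes c d :: "real \<Rightarrow> complex"
  assumes "arc c" "arc d" "pathstart c = a" "pathfinish c = b" "pathstart d = a" "pathfinish d = b"
    and "path_image c \<inter> path_image d = {a, b}"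
  shows "connected (inside (path_image c \<union> path_image d))"
    and "inside (path_image c \<union> path_image d) \<noteq> {}"
    and "frontier (inside (path_image c \<union> path_image d)) = path_image c \<union> path_image d"
  using Jordan_inside_outside[OF arc_loop(1,3)[OF assms]] arc_loop(2)[OF assms] by auto

text \<open>The difference of the two winding numbers is that of the loop
  \<open>c +++ reversepath d\<close>, which has norm 1 inside a simple closed curve and is 0
  outside. Phrased for single arcs, equalities can be chained over three arcs.\<close>

lemma arc_loop_winding_number:
  fixes c d :: "real \<Rightarrow> complex"
  assumes "arc c" "arc d" "pathstart c = a" "pathfinish c = b" "pathstart d = a" "pathfinish d = b"
    and "path_image c \<inter> path_image d = {a, b}"
    and z: "z \<notin> path_image c \<union> path_image d"
  shows "winding_number c z = winding_number d z \<longleftrightarrow> z \<notin> inside (path_image c \<union> path_image d)"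
proof -
  note loop = arc_loop[OF assms(1-7)]
  have w: "winding_number (c +++ reversepath d) z = winding_number c z - winding_number d z"
    using assms by (simp add: winding_number_join winding_number_reversepath arc_imp_path)
  show ?thesis
  proof (cases "z \<in> inside (path_image c \<union> path_image d)")
    case True
    then have "z \<in> inside (path_image (c +++ reversepath d))" unfolding loop(2) .
    then have "norm (winding_number (c +++ reversepath d) z) = 1"
      by (rule simple_closed_path_norm_winding_number_inside[OF loop(1)])
    then have "winding_number c z \<noteq> winding_number d z" unfolding w by auto
    with True show ?thesis by blast
  next
    case False
    then have "z \<in> outside (path_image (c +++ reversepath d))"
      using z inside_Un_outside[of "path_image c \<union> path_image d"] unfolding loop(2) by blast
    then have "winding_number (c +++ reversepath d) z = 0"
      using loop winding_number_zero_in_outside simple_path_imp_path by blast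
    then have "winding_number c z = winding_number d z" unfolding w by simp
    with False show ?thesis by blast
  qed
qed

text \<open>If the two insides met, each, being connected and disjoint from the other loop, would
  lie in the other. Equal insides have equal frontiers, so \<open>d\<close> would lie in the union
  of \<open>c\<close> and \<open>e\<close>, which \<open>v\<close> refutes.\<close>

lemma theta_loops_inside_disjoint:
  fixes c d e :: "real \<Rightarrow> complex"
  assumes c: "arc c" "pathstart c = a" "pathfinish c = b"
    and d: "arc d" "pathstart d = a" "pathfinish d = b"
    and e: "arc e" "pathstart e = a" "pathfinish e = b"
    and cd: "path_image c \<inter> path_image d = {a, b}"
    and ce: "path_image c \<inter> path_image e = {a, b}"
    and de: "path_image d \<inter> path_image e = {a, b}"
    and v: "v \<in> path_image d" "v \<noteq> a" "v \<noteq> b"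
    and out: "inside (path_image c \<union> path_image d) \<inter> path_image e = {}"
             "inside (path_image c \<union> path_image e) \<inter> path_image d = {}"
  shows "inside (path_image c \<union> path_image d) \<inter> inside (path_image c \<union> path_image e) = {}"
proof (rule ccontr)
  let ?I = "inside (path_image c \<union> path_image d)" and ?J = "inside (path_image c \<union> path_image e)"
  note I = arc_loop_inside[OF c(1) d(1) c(2,3) d(2,3) cd]
  note J = arc_loop_inside[OF c(1) e(1) c(2,3) e(2,3) ce]
  assume ne: "?I \<inter> ?J \<noteq> {}"
  have "?I \<subseteq> ?J"
    using connected_subset_inside[OF I(1), of "path_image c \<union> path_image e"] ne out(1)
      inside_no_overlap[of "path_image c \<union> path_image d"] by blast
  moreover have "?J \<subseteq> ?I"
    using connected_subset_inside[OF J(1), of "path_image c \<union> path_image d"] ne out(2)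
      inside_no_overlap[of "path_image c \<union> path_image e"] by blast
  ultimately have "?I = ?J" by blast
  then have "path_image c \<union> path_image d = path_image c \<union> path_image e"
    using I(3) J(3) by metis
  with v cd de show False by blast
qed

text \<open>The winding numbers of the three loops satisfy a linear relation, so a point inside the
  first loop is inside one of the other two.\<close>

lemma theta_some_arc_inside:
  fixes c d e :: "real \<Rightarrow> complex"
  assumes c: "arc c" "pathstart c = a" "pathfinish c = b"
    and d: "arc d" "pathstart d = a" "pathfinish d = b"
    and e: "arc e" "pathstart e = a" "pathfinish e = b"
    and cd: "path_image c \<inter> path_image d = {a, b}"
    and ce: "path_image c \<inter> path_image e = {a, b}"
    and de: "path_image d \<inter> path_image e = {a, b}"
    and u: "u \<in> path_image c - {a, b}" and v: "v \<in> path_image d - {a, b}"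
    and w: "w \<in> path_image e - {a, b}"
  shows "u \<in> inside (path_image d \<union> path_image e) \<or> v \<in> inside (path_image c \<union> path_image e) \<or>
    w \<in> inside (path_image c \<union> path_image d)"
proof (rule ccontr)
  assume "\<not> ?thesis"
  then have not_in: "u \<notin> inside (path_image d \<union> path_image e)"
    "v \<notin> inside (path_image c \<union> path_image e)" "w \<notin> inside (path_image c \<union> path_image d)" by auto
  \<comment> \<open>An arc without its ends is connected and avoids the loop of the other two arcs,
    so a single point \<open>t\<close> that is not inside decides for the whole arc.\<close>
  have out: "inside (path_image f \<union> path_image g) \<inter> path_image h = {}"
    if "arc h" "pathstart h = a" "pathfinish h = b" "path_image f \<inter> path_image g = {a, b}"
       "path_image f \<inter> path_image h = {a, b}" "path_image g \<inter> path_image h = {a, b}"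
       "t \<in> path_image h - {a, b}" "t \<notin> inside (path_image f \<union> path_image g)" for f g h t
  proof (rule ccontr)
    assume "\<not> ?thesis"
    moreover have "{a, b} \<inter> inside (path_image f \<union> path_image g) = {}"
      using that(4) inside_no_overlap[of "path_image f \<union> path_image g"] by blast
    ultimately have "(path_image h - {a, b}) \<inter> inside (path_image f \<union> path_image g) \<noteq> {}" by blast
    moreover have "connected (path_image h - {a, b})"
      using connected_simple_path_endless[OF arc_imp_simple_path] that(1,2,3) by metis
    ultimately have "path_image h - {a, b} \<subseteq> inside (path_image f \<union> path_image g)"
      using that(5,6) by (intro connected_subset_inside) blast+
    with that show False by blast
  qed
  have out_e: "inside (path_image c \<union> path_image d) \<inter> path_image e = {}"
    using out[OF e cd ce de w] not_in by blast
  have out_d: "inside (path_image c \<union> path_image e) \<inter> path_image d = {}"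
    using out[OF d ce cd _ v] not_in de by blast
  have out_c: "inside (path_image d \<union> path_image e) \<inter> path_image c = {}"
    using out[OF c de _ _ u] not_in cd ce by blast
  \<comment> \<open>At this test point \<open>c\<close> and \<open>e\<close> have equal winding
    numbers, and so have \<open>d\<close> and \<open>e\<close>. Hence \<open>c\<close> and
    \<open>d\<close> agree too, although \<open>z\<close> is inside their loop.\<close>
  obtain z where z: "z \<in> inside (path_image c \<union> path_image d)"
    using arc_loop_inside(2)[OF c(1) d(1) c(2,3) d(2,3) cd] by blast
  have z_off: "z \<notin> path_image c \<union> path_image d" "z \<notin> path_image e"
    using z inside_no_overlap[of "path_image c \<union> path_image d"] out_e by blast+
  have "inside (path_image c \<union> path_image d) \<inter> inside (path_image c \<union> path_image e) = {}"
    using v by (intro theta_loops_inside_disjoint[OF c d e cd ce de _ _ _ out_e out_d]) auto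
  then have "winding_number c z = winding_number e z"
    using z z_off arc_loop_winding_number[OF c(1) e(1) c(2,3) e(2,3) ce] by blast
  moreover have "inside (path_image d \<union> path_image c) \<inter> inside (path_image d \<union> path_image e) = {}"
    using u out_c out_e cd ce de
    by (intro theta_loops_inside_disjoint[OF d c e, where v = u]) (auto simp: Un_commute)
  then have "winding_number d z = winding_number e z"
    using z z_off arc_loop_winding_number[OF d(1) e(1) d(2,3) e(2,3) de] by (auto simp: Un_commute)
  ultimately show False
    using z z_off arc_loop_winding_number[OF c(1) d(1) c(2,3) d(2,3) cd, of z] by simp
qed

section \<open>Vertex walks as arcs of a plane drawing\<close>

fun walk_edges :: "'a list \<Rightarrow> 'a set set" where
  "walk_edges (x # y # zs) = insert {x, y} (walk_edges (y # zs))"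
| "walk_edges _ = {}"

lemma walk_edges_subset: "e \<in> walk_edges xs \<Longrightarrow> e \<subseteq> set xs"
  by (induction xs rule: walk_edges.induct) auto

lemma Union_walk_edges: "\<Union> (walk_edges (x # y # zs)) = set (x # y # zs)"
  by (induction zs arbitrary: x y) auto

lemma finite_walk_edges: "finite (walk_edges xs)"
  by (induction xs rule: walk_edges.induct) auto

text \<open>The first edge contains \<open>p\<close>, and the later ones miss \<open>a\<close>. This
  makes two walks from \<open>a\<close> to \<open>b\<close> without other common vertices
  edge-disjoint, since they could share only \<open>{a, b}\<close>.\<close>

lemma ends_notin_walk_edges:
  assumes "distinct (a # p # ps @ [b])"
  shows "{a, b} \<notin> walk_edges (a # p # ps @ [b])"
  using assms walk_edges_subset[of "{a, b}" "p # ps @ [b]"] by (auto simp: doubleton_eq_iff)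

lemma edge_images_Int:
  assumes "drawing G pos \<gamma>" "\<not> crosses G pos \<gamma> e f" "e \<in> edges G" "f \<in> edges G" "e \<noteq> f"
    and "e \<subseteq> verts G" "f \<subseteq> verts G"
  shows "path_image (\<gamma> e) \<inter> path_image (\<gamma> f) \<subseteq> pos ` (e \<inter> f)"
proof
  fix z assume z: "z \<in> path_image (\<gamma> e) \<inter> path_image (\<gamma> f)"
  with assms have "z \<in> pos ` verts G" by (auto simp: crosses_def)
  moreover have "path_image (\<gamma> e) \<inter> pos ` verts G = pos ` e" "path_image (\<gamma> f) \<inter> pos ` verts G = pos ` f"
    using assms(1,3,4) by (auto simp: drawing_def)
  ultimately have "z \<in> pos ` e \<inter> pos ` f" using z by blast
  moreover have "inj_on pos (verts G)" using assms by (simp add: drawing_def)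
  ultimately show "z \<in> pos ` (e \<inter> f)"
    using inj_on_image_Int[of pos "verts G" e f] assms by auto
qed

locale plane_drawing =
  fixes G :: "'a ugraph" and pos :: "'a \<Rightarrow> complex" and \<gamma> :: "'a set \<Rightarrow> real \<Rightarrow> complex"
  assumes simple: "simple_graph G" and drawing: "drawing G pos \<gamma>"
    and no_cross: "\<And>e f. e \<in> edges G \<Longrightarrow> f \<in> edges G \<Longrightarrow> \<not> crosses G pos \<gamma> e f"
begin

lemma edge_sets_Int:
  assumes "E \<subseteq> edges G" "F \<subseteq> edges G" "E \<inter> F = {}"
  shows "(\<Union>e\<in>E. path_image (\<gamma> e)) \<inter> (\<Union>e\<in>F. path_image (\<gamma> e)) \<subseteq> pos ` (\<Union>E \<inter> \<Union>F)"
proof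
  fix z assume "z \<in> (\<Union>e\<in>E. path_image (\<gamma> e)) \<inter> (\<Union>e\<in>F. path_image (\<gamma> e))"
  then obtain e f where ef: "e \<in> E" "f \<in> F" "z \<in> path_image (\<gamma> e) \<inter> path_image (\<gamma> f)" by blast
  with assms have "e \<in> edges G" "f \<in> edges G" "e \<noteq> f" by auto
  moreover from this simple have "e \<subseteq> verts G" "f \<subseteq> verts G" by (auto simp: simple_graph_def)
  ultimately have "z \<in> pos ` (e \<inter> f)"
    using edge_images_Int[OF drawing no_cross] ef by blast
  with ef show "z \<in> pos ` (\<Union>E \<inter> \<Union>F)" by blast
qed

lemma edge_arc:
  assumes "{x, y} \<in> edges G"
  obtains g where "arc g" "pathstart g = pos x" "pathfinish g = pos y"
    "path_image g = path_image (\<gamma> {x, y})"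
proof -
  have ar: "arc (\<gamma> {x, y})" and ends: "{pathstart (\<gamma> {x, y}), pathfinish (\<gamma> {x, y})} = {pos x, pos y}"
    using drawing assms by (auto simp: drawing_def)
  show ?thesis
  proof (cases "pathstart (\<gamma> {x, y}) = pos x")
    case True
    with ar ends show ?thesis by (intro that[of "\<gamma> {x, y}"]) (auto simp: doubleton_eq_iff)
  next
    case False
    with ar ends show ?thesis
      by (intro that[of "reversepath (\<gamma> {x, y})"]) (auto simp: doubleton_eq_iff arc_reversepath)
  qed
qed

lemma walk_arc:
  assumes "distinct (x # y # zs)" "walk_edges (x # y # zs) \<subseteq> edges G"
  shows "\<exists>g. arc g \<and> pathstart g = pos x \<and> pathfinish g = pos (last (y # zs)) \<and>
    path_image g = (\<Union>e\<in>walk_edges (x # y # zs). path_image (\<gamma> e))"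
  using assms
proof (induction zs arbitrary: x y)
  case Nil
  then have "{x, y} \<in> edges G" by simp
  then obtain g where "arc g" "pathstart g = pos x" "pathfinish g = pos y"
    "path_image g = path_image (\<gamma> {x, y})" by (rule edge_arc)
  then show ?case by (intro exI[of _ g]) simp
next
  case (Cons z zs)
  have "\<exists>g. arc g \<and> pathstart g = pos y \<and> pathfinish g = pos (last (z # zs)) \<and>
    path_image g = (\<Union>e\<in>walk_edges (y # z # zs). path_image (\<gamma> e))"
    using Cons.prems by (intro Cons.IH) auto
  then obtain g where g: "arc g" "pathstart g = pos y" "pathfinish g = pos (last (z # zs))"
    "path_image g = (\<Union>e\<in>walk_edges (y # z # zs). path_image (\<gamma> e))" by blast
  have "{x, y} \<in> edges G" using Cons.prems by simp
  then obtain h where h: "arc h" "pathstart h = pos x" "pathfinish h = pos y"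
    "path_image h = path_image (\<gamma> {x, y})" by (rule edge_arc)
  \<comment> \<open>Since \<open>x\<close> does not recur, the first edge is not a later one and
    meets the rest only in \<open>pos y\<close>, as joining arcs requires.\<close>
  have "{x, y} \<notin> walk_edges (y # z # zs)"
    using walk_edges_subset[of "{x, y}" "y # z # zs"] Cons.prems by auto
  then have "path_image h \<inter> path_image g \<subseteq> pos ` (\<Union>{{x, y}} \<inter> \<Union>(walk_edges (y # z # zs)))"
    using edge_sets_Int[of "{{x, y}}" "walk_edges (y # z # zs)"] Cons.prems h(4) g(4) by simp
  also have "\<dots> \<subseteq> {pos y}"
    using Cons.prems unfolding Union_walk_edges by auto
  finally have "path_image h \<inter> path_image g \<subseteq> {pathstart g}" using g(2) by simp
  then have "arc (h +++ g)" using h g by (intro arc_join) auto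
  moreover have "path_image (h +++ g) = (\<Union>e\<in>walk_edges (x # y # z # zs). path_image (\<gamma> e))"
    using h g by (simp add: path_image_join)
  ultimately show ?case using h g by (intro exI[of _ "h +++ g"]) simp
qed

end

section \<open>The outer face and forbidden theta subgraphs\<close>

lemma closed_drawing_part:
  assumes "drawing G pos \<gamma>" "E \<subseteq> edges G" "finite E"
  shows "closed (\<Union>e\<in>E. path_image (\<gamma> e))"
  using assms by (intro closed_UN) (auto simp: drawing_def closed_arc_image)

text \<open>\<open>inside K\<close> is open, so with a frontier point of \<open>outside D\<close> it
  would meet \<open>outside D\<close>, which is contained in \<open>outside K\<close>. Hence no
  vertex on the outer face is enclosed by a closed part of the drawing.\<close>

lemma frontier_outside_notin_inside:
  fixes K :: "complex set"
  assumes "z \<in> frontier (outside D)" "closed K" "K \<subseteq> D"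
  shows "z \<notin> inside K"
proof
  assume "z \<in> inside K"
  moreover have "z \<in> closure (outside D)" using assms(1) by (simp add: frontier_def)
  ultimately have "inside K \<inter> outside D \<noteq> {}"
    using open_Int_closure_eq_empty[OF open_inside[OF assms(2)]] by blast
  moreover have "outside D \<subseteq> outside K" by (rule outside_mono[OF assms(3)])
  ultimately show False using inside_Int_outside[of K] by blast
qed

text \<open>The form \<open>a # p # ps @ [b]\<close> guarantees an inner vertex on each walk. One of
  \<open>p\<close>, \<open>q\<close>, \<open>r\<close> lies inside the loop of the other two walks,
  so it cannot be on the outer face.\<close>

lemma outerplanar_no_theta:
  assumes "outerplanar H"
    and "walk_edges (a # p # ps @ [b]) \<subseteq> edges H" "walk_edges (a # q # qs @ [b]) \<subseteq> edges H"
        "walk_edges (a # r # rs @ [b]) \<subseteq> edges H"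
    and "distinct (a # b # p # ps @ q # qs @ r # rs)"
  shows False
proof -
  obtain pos \<gamma> where dr: "drawing H pos \<gamma>"
    and nc: "\<And>e f. e \<in> edges H \<Longrightarrow> f \<in> edges H \<Longrightarrow> \<not> crosses H pos \<gamma> e f"
    and fr: "\<And>v. v \<in> verts H \<Longrightarrow> pos v \<in> frontier (outside (drawing_image H pos \<gamma>))"
    and simple: "simple_graph H"
    using assms(1) unfolding outerplanar_def by blast
  interpret plane_drawing H pos \<gamma> by unfold_locales (use simple dr nc in auto)
  let ?P = "\<lambda>x xs. \<Union>e\<in>walk_edges (a # x # xs @ [b]). path_image (\<gamma> e)"
  have arcs: "\<exists>g. arc g \<and> pathstart g = pos a \<and> pathfinish g = pos b \<and> path_image g = ?P x xs"
    if "walk_edges (a # x # xs @ [b]) \<subseteq> edges H" "distinct (a # x # xs @ [b])" for x xs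
    using walk_arc[OF that(2,1)] by simp
  have verts: "set (a # x # xs @ [b]) \<subseteq> verts H"
    if "walk_edges (a # x # xs @ [b]) \<subseteq> edges H" for x xs
    using that simple Union_walk_edges[of a x "xs @ [b]"] unfolding simple_graph_def by blast
  have in_image: "pos y \<in> ?P x xs"
    if "walk_edges (a # x # xs @ [b]) \<subseteq> edges H" "y \<in> set (a # x # xs @ [b])" for x xs y
  proof -
    have "y \<in> \<Union>(walk_edges (a # x # xs @ [b]))" unfolding Union_walk_edges by (rule that(2))
    then obtain e where e: "e \<in> walk_edges (a # x # xs @ [b])" "y \<in> e" by (rule UnionE)
    then have "path_image (\<gamma> e) \<inter> pos ` verts H = pos ` e"
      using that(1) dr unfolding drawing_def by (meson subsetD)
    with e(2) have "pos y \<in> path_image (\<gamma> e)" by blast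
    with e(1) show ?thesis by (rule UN_I)
  qed
  have meet: "?P x xs \<inter> ?P y ys = {pos a, pos b}"
    if "walk_edges (a # x # xs @ [b]) \<subseteq> edges H" "walk_edges (a # y # ys @ [b]) \<subseteq> edges H"
       "distinct (a # b # x # xs @ y # ys)" for x xs y ys
  proof -
    have inter: "set (a # x # xs @ [b]) \<inter> set (a # y # ys @ [b]) = {a, b}" using that(3) by auto
    have "walk_edges (a # x # xs @ [b]) \<inter> walk_edges (a # y # ys @ [b]) = {}"
    proof (rule ccontr)
      assume "\<not> ?thesis"
      then obtain e where e: "e \<in> walk_edges (a # x # xs @ [b])" "e \<in> walk_edges (a # y # ys @ [b])"
        by (meson disjoint_iff)
      then have "e \<subseteq> {a, b}" using walk_edges_subset inter by (metis le_inf_iff)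
      moreover have "card e = 2" using subsetD[OF that(1) e(1)] simple by (simp add: simple_graph_def)
      ultimately have "e = {a, b}" using that(3) by (intro card_seteq) auto
      then show False using e(1) ends_notin_walk_edges[of a x xs b] that(3) by auto
    qed
    then have "?P x xs \<inter> ?P y ys \<subseteq> pos ` (set (a # x # xs @ [b]) \<inter> set (a # y # ys @ [b]))"
      using edge_sets_Int[OF that(1,2)] unfolding Union_walk_edges by simp
    then have "?P x xs \<inter> ?P y ys \<subseteq> {pos a, pos b}" unfolding inter by simp
    moreover have "{pos a, pos b} \<subseteq> ?P x xs \<inter> ?P y ys"
      using in_image[OF that(1), of a] in_image[OF that(1), of b]
        in_image[OF that(2), of a] in_image[OF that(2), of b] by simp
    ultimately show ?thesis by blast
  qed
  have inner: "pos x \<in> ?P x xs - {pos a, pos b}"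
    if "walk_edges (a # x # xs @ [b]) \<subseteq> edges H" "x \<noteq> a" "x \<noteq> b" for x xs
    using in_image[OF that(1), of x] verts[OF that(1)] dr that(2,3)
    by (auto simp: drawing_def dest: inj_onD)
  have out: "pos x \<notin> inside (?P y ys \<union> ?P z zs)"
    if "walk_edges (a # x # xs @ [b]) \<subseteq> edges H" "walk_edges (a # y # ys @ [b]) \<subseteq> edges H"
       "walk_edges (a # z # zs @ [b]) \<subseteq> edges H" for x xs y ys z zs
  proof (rule frontier_outside_notin_inside[OF fr])
    show "x \<in> verts H" using verts[OF that(1)] by simp
    show "closed (?P y ys \<union> ?P z zs)"
      by (intro closed_Un closed_drawing_part[OF dr] that finite_walk_edges)
    show "?P y ys \<union> ?P z zs \<subseteq> drawing_image H pos \<gamma>"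
      using that unfolding drawing_image_def by blast
  qed
  obtain f where f: "arc f" "pathstart f = pos a" "pathfinish f = pos b" "path_image f = ?P p ps"
    using arcs[OF assms(2)] assms(5) by auto
  obtain g where g: "arc g" "pathstart g = pos a" "pathfinish g = pos b" "path_image g = ?P q qs"
    using arcs[OF assms(3)] assms(5) by auto
  obtain h where h: "arc h" "pathstart h = pos a" "pathfinish h = pos b" "path_image h = ?P r rs"
    using arcs[OF assms(4)] assms(5) by auto
  have pq: "?P p ps \<inter> ?P q qs = {pos a, pos b}" using assms(5) by (intro meet assms(2-4)) auto
  have pr: "?P p ps \<inter> ?P r rs = {pos a, pos b}" using assms(5) by (intro meet assms(2-4)) auto
  have qr: "?P q qs \<inter> ?P r rs = {pos a, pos b}" using assms(5) by (intro meet assms(2-4)) auto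
  have p: "pos p \<in> ?P p ps - {pos a, pos b}" using assms(5) by (intro inner assms(2)) auto
  have q: "pos q \<in> ?P q qs - {pos a, pos b}" using assms(5) by (intro inner assms(3)) auto
  have r: "pos r \<in> ?P r rs - {pos a, pos b}" using assms(5) by (intro inner assms(4)) auto
  from theta_some_arc_inside[OF f(1-3) g(1-3) h(1-3), unfolded f(4) g(4) h(4), OF pq pr qr p q r]
  show False using out[OF assms(2,3,4)] out[OF assms(3,2,4)] out[OF assms(4,2,3)] by argo
qed


section \<open>Matchings against copies of K_{2,3}\<close>

lemma matching_mate_unique:
  assumes "matching M" "{a, b} \<in> M" "{a, c} \<in> M"
  shows "b = c"
proof -
  have "{a, b} \<inter> {a, c} \<noteq> {}" by simp
  then have "{a, b} = {a, c}" using assms unfolding matching_def by metis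
  then show ?thesis by (auto simp: doubleton_eq_iff)
qed

lemma doubleton_edge_swap: "{a, b} \<in> E \<Longrightarrow> {b, a} \<in> E"
  by (simp add: insert_commute)

lemma outerplanar_no_K23:
  assumes "outerplanar H" "distinct [a, b, x, y, z]"
    and "{a, x} \<in> edges H" "{a, y} \<in> edges H" "{a, z} \<in> edges H"
    and "{b, x} \<in> edges H" "{b, y} \<in> edges H" "{b, z} \<in> edges H"
  shows False
  by (rule outerplanar_no_theta[OF assms(1), of a x "[]" b y "[]" z "[]"])
    (use assms(2-) assms(6-)[THEN doubleton_edge_swap] in simp_all)

lemma outerplanar_no_subdivided_K23:
  assumes "outerplanar H" "distinct [a, b, x, y, u, w]"
    and "{a, x} \<in> edges H" "{a, y} \<in> edges H" "{a, u} \<in> edges H"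
    and "{b, x} \<in> edges H" "{b, y} \<in> edges H" "{u, w} \<in> edges H" "{b, w} \<in> edges H"
  shows False
  by (rule outerplanar_no_theta[OF assms(1), of a x "[]" b y "[]" u "[w]"])
    (use assms(2-) assms(6-)[THEN doubleton_edge_swap] in simp_all)

text \<open>Here \<open>a\<close>, \<open>b\<close> are the ends of a side, \<open>x\<close>,
  \<open>y\<close> its outer vertices and \<open>u\<close>, \<open>w\<close> the other hubs. If all
  four edges stay in \<open>H\<close>, then \<open>M\<close> must break every path from
  \<open>a\<close> to \<open>b\<close> with inner vertices among \<open>u\<close>, \<open>w\<close>.
  For the two of length 2 a matching needs \<open>{a, u}\<close> and \<open>{b, w}\<close>, or
  \<open>{a, w}\<close> and \<open>{b, u}\<close>; then one of length 3 survives.\<close>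

lemma matched_side_edge:
  assumes H: "outerplanar H" and M: "matching M" and dist: "distinct [a, b, x, y, u, w]"
    and E: "{a, x} \<in> edges H \<union> M" "{a, y} \<in> edges H \<union> M" "{b, x} \<in> edges H \<union> M"
      "{b, y} \<in> edges H \<union> M" "{a, u} \<in> edges H \<union> M" "{a, w} \<in> edges H \<union> M"
      "{b, u} \<in> edges H \<union> M" "{b, w} \<in> edges H \<union> M" "{u, w} \<in> edges H \<union> M"
  shows "{a, x} \<in> M \<or> {a, y} \<in> M \<or> {b, x} \<in> M \<or> {b, y} \<in> M"
proof (rule ccontr)
  assume "\<not> ?thesis"
  with E have xy: "{a, x} \<in> edges H" "{a, y} \<in> edges H" "{b, x} \<in> edges H" "{b, y} \<in> edges H" by auto
  have au_bu: "{a, u} \<in> M \<or> {b, u} \<in> M"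
    using outerplanar_no_K23[OF H, of a b x y u] xy E dist by auto
  have aw_bw: "{a, w} \<in> M \<or> {b, w} \<in> M"
    using outerplanar_no_K23[OF H, of a b x y w] xy E dist by auto
  have au_uw_bw: "{a, u} \<in> M \<or> {u, w} \<in> M \<or> {b, w} \<in> M"
    using outerplanar_no_subdivided_K23[OF H, of a b x y u w] xy E dist by auto
  have aw_uw_bu: "{a, w} \<in> M \<or> {u, w} \<in> M \<or> {b, u} \<in> M"
    using outerplanar_no_subdivided_K23[OF H, of a b x y w u] xy E dist by (auto simp: insert_commute)
  have at_a: "\<not> ({a, u} \<in> M \<and> {a, w} \<in> M)"
    using matching_mate_unique[OF M, of a u w] dist by auto
  have at_b: "\<not> ({b, u} \<in> M \<and> {b, w} \<in> M)"
    using matching_mate_unique[OF M, of b u w] dist by auto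
  have at_u: "\<not> ({a, u} \<in> M \<and> {b, u} \<in> M)" "\<not> ({a, u} \<in> M \<and> {u, w} \<in> M)"
      "\<not> ({b, u} \<in> M \<and> {u, w} \<in> M)"
    using matching_mate_unique[OF M, of u a b] matching_mate_unique[OF M, of u a w]
      matching_mate_unique[OF M, of u b w] dist by (auto simp: insert_commute)
  show False using au_bu aw_bw au_uw_bw aw_uw_bu at_a at_b at_u by argo
qed

text \<open>The only edges of \<open>M\<close> at \<open>a\<close> and \<open>b\<close> lead to
  \<open>p\<close> and \<open>q\<close>, so the six edges to \<open>x\<close>, \<open>y\<close>,
  \<open>z\<close> stay in \<open>H\<close>.\<close>

lemma unmatched_K23:
  assumes H: "outerplanar H" and M: "matching M"
    and "{a, p} \<in> M" "{b, q} \<in> M" "distinct [a, b, x, y, z]" "{p, q} \<inter> {x, y, z} = {}"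
    and E: "{a, x} \<in> edges H \<union> M" "{a, y} \<in> edges H \<union> M" "{a, z} \<in> edges H \<union> M"
      "{b, x} \<in> edges H \<union> M" "{b, y} \<in> edges H \<union> M" "{b, z} \<in> edges H \<union> M"
  shows False
proof -
  have "{a, t} \<notin> M" "{b, t} \<notin> M" if "t \<in> {x, y, z}" for t
    using matching_mate_unique[OF M] assms(3,4,6) that by blast+
  with E have "{a, t} \<in> edges H" "{b, t} \<in> edges H" if "t \<in> {x, y, z}" for t
    using that by auto
  then show False using outerplanar_no_K23[OF H assms(5)] by simp
qed

section \<open>Connectivity and blocks\<close>

lemma sym_adj_rel_rtrancl: "(u, v) \<in> (adj_rel G)\<^sup>* \<Longrightarrow> (v, u) \<in> (adj_rel G)\<^sup>*"
  by (rule symD[OF sym_rtrancl]) (auto simp: sym_def adj_rel_def insert_commute)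

lemma connected_graphI:
  assumes "r \<in> verts G" "\<And>v. v \<in> verts G \<Longrightarrow> (v, r) \<in> (adj_rel G)\<^sup>*"
  shows "connected_graph G"
  unfolding connected_graph_def
proof (intro conjI ballI)
  show "verts G \<noteq> {}" using assms(1) by blast
  show "(u, v) \<in> (adj_rel G)\<^sup>*" if "u \<in> verts G" "v \<in> verts G" for u v
    using assms(2)[OF that(1)] sym_adj_rel_rtrancl[OF assms(2)[OF that(2)]] by (rule rtrancl_trans)
qed

lemma interval_path:
  fixes G :: "nat ugraph"
  assumes "i \<le> j" "\<And>k. i \<le> k \<Longrightarrow> k < j \<Longrightarrow> {k, Suc k} \<in> edges G"
  shows "(i, j) \<in> (adj_rel G)\<^sup>*"
  using assms
proof (induction j rule: dec_induct)
  case (step k)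
  then have "(k, Suc k) \<in> adj_rel G" by (simp add: adj_rel_def)
  with step show ?case by (meson less_Suc_eq rtrancl.rtrancl_into_rtrancl)
qed simp

lemma two_connected_hamiltonian:
  fixes G :: "nat ugraph"
  assumes "simple_graph G" "verts G = {..<n}" "3 \<le> n"
    and step: "\<And>i. Suc i < n \<Longrightarrow> {i, Suc i} \<in> edges G" and close: "{0, n - 1} \<in> edges G"
  shows "two_connected G"
proof -
  have "connected_graph (delete_vertex G v)" if "v < n" for v
  proof -
    let ?D = "delete_vertex G v"
    have V: "verts ?D = {..<n} - {v}" using assms(2) by (simp add: delete_vertex_def)
    have path: "(i, j) \<in> (adj_rel ?D)\<^sup>*" if "i \<le> j" "j < n" "j < v \<or> v < i" for i j
      using that step by (intro interval_path) (auto simp: delete_vertex_def)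
    \<comment> \<open>Deleting 0 leaves an interval. Otherwise vertices below \<open>v\<close>
      descend to 0, and those above climb to \<open>n - 1\<close> and use the closing edge.\<close>
    show ?thesis
    proof (cases "v = 0")
      case True
      with V path assms(3) show ?thesis by (intro connected_graphI[of "n - 1"]) auto
    next
      case False
      have "(u, 0) \<in> (adj_rel ?D)\<^sup>*" if "u < n" "u \<noteq> v" for u
      proof (cases "u < v")
        case True
        with that show ?thesis by (intro sym_adj_rel_rtrancl[OF path]) auto
      next
        case u: False
        with that have "(u, n - 1) \<in> (adj_rel ?D)\<^sup>*" by (intro path) auto
        moreover have "(n - 1, 0) \<in> adj_rel ?D"
          using close False u that by (auto simp: adj_rel_def delete_vertex_def insert_commute)
        ultimately show ?thesis by (rule rtrancl_into_rtrancl)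
      qed
      with V False assms(3) show ?thesis by (intro connected_graphI[of 0]) auto
    qed
  qed
  moreover have "connected_graph G"
    using assms(2,3) step
    by (intro connected_graphI[of "n - 1"]) (auto intro!: interval_path)
  ultimately show ?thesis using assms(1-3) by (simp add: two_connected_def)
qed

text \<open>\<open>G\<close> itself competes in the maximality of \<open>B\<close>. Hence one
  drawing of the whole graph will show pseudo-outerplanarity.\<close>

lemma is_block_two_connected:
  assumes "two_connected G" "is_block B G"
  shows "B = G"
proof -
  have "subgraph B G" and max: "subgraph G G \<and> two_connected G \<and> subgraph B G \<longrightarrow> G = B"
    using assms(2) by (auto simp: is_block_def)
  moreover have "subgraph G G" using assms(1) by (simp add: subgraph_def two_connected_def)
  ultimately show ?thesis using assms(1) by simp
qed

section \<open>Straight chords of a circle\<close>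

text \<open>The image of the real line under \<open>t \<mapsto> 1 / (t - \<i>)\<close> is a circle through \<open>0\<close>; the chord
  through the points of \<open>s\<close> and \<open>t\<close> is the zero set of the affine functional \<open>chord_side s t\<close>,
  whose sign at a point of the circle is rational in the parameter.\<close>

definition circle_point :: "real \<Rightarrow> complex" where
  "circle_point t = Complex (t / (t\<^sup>2 + 1)) (1 / (t\<^sup>2 + 1))"

definition chord_side :: "real \<Rightarrow> real \<Rightarrow> complex \<Rightarrow> real" where
  "chord_side s t z = 1 - (s + t) * Re z + (s * t - 1) * Im z"

lemma sq_plus_one_pos: "0 < t\<^sup>2 + (1::real)"
  by (simp add: add_nonneg_pos)

lemma chord_side_circle_point:
  "chord_side s t (circle_point u) = (u - s) * (u - t) / (u\<^sup>2 + 1)"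
proof -
  have "u\<^sup>2 + 1 \<noteq> 0" using sq_plus_one_pos[of u] by simp
  then show ?thesis
    by (simp add: chord_side_def circle_point_def divide_simps) (simp add: algebra_simps power2_eq_square)
qed

lemma chord_side_convex:
  "chord_side s t ((1 - u) *\<^sub>R x + u *\<^sub>R y) = (1 - u) * chord_side s t x + u * chord_side s t y"
  by (simp add: chord_side_def algebra_simps)

lemma chord_side_segment:
  "z \<in> closed_segment (circle_point s) (circle_point t) \<Longrightarrow> chord_side s t z = 0"
  by (auto simp: in_segment chord_side_convex chord_side_circle_point)

lemma circle_point_on_chord:
  assumes "circle_point u \<in> closed_segment (circle_point s) (circle_point t)"
  shows "u = s \<or> u = t"
  using chord_side_segment[OF assms] sq_plus_one_pos[of u] by (auto simp: chord_side_circle_point)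

lemma inj_circle_point: "inj circle_point"
proof
  fix s t assume "circle_point s = circle_point t"
  then show "s = t" using circle_point_on_chord[of s t t] by simp
qed

lemma circle_point_sphere: "circle_point t \<in> sphere (Complex 0 (1/2)) (1/2)"
proof -
  have pos: "t\<^sup>2 + 1 \<noteq> 0" using sq_plus_one_pos[of t] by simp
  have "(Re (Complex 0 (1/2) - circle_point t))\<^sup>2 + (Im (Complex 0 (1/2) - circle_point t))\<^sup>2 = (1/2)\<^sup>2"
    using pos by (simp add: circle_point_def divide_simps) (simp add: algebra_simps power2_eq_square)
  then show ?thesis by (simp add: dist_norm cmod_def)
qed

text \<open>With \<open>p\<close> and \<open>q\<close> the values of an affine functional at the
  ends of a segment: a segment on one closed side of a line and not contained in it meets the line
  at most in its ends.\<close>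

lemma nonneg_convex_zero:
  fixes p q u :: real
  assumes "0 \<le> u" "u \<le> 1" "(1 - u) * p + u * q = 0" "0 \<le> p * q" "p \<noteq> 0 \<or> q \<noteq> 0"
  shows "u = 0 \<or> u = 1"
proof (rule ccontr)
  assume "\<not> ?thesis"
  with assms have u: "0 < u" "0 < 1 - u" by auto
  consider "0 \<le> p" "0 \<le> q" | "p \<le> 0" "q \<le> 0" using assms(4) by (auto simp: zero_le_mult_iff)
  then show False
  proof cases
    case 1
    then have "(1 - u) * p \<ge> 0" "u * q \<ge> 0" using u by auto
    then have "(1 - u) * p = 0" "u * q = 0" using assms(3) by linarith+
    with u assms(5) show False by simp
  next
    case 2
    then have "(1 - u) * p \<le> 0" "u * q \<le> 0" using u by (auto simp: mult_le_0_iff)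
    then have "(1 - u) * p = 0" "u * q = 0" using assms(3) by linarith+
    with u assms(5) show False by simp
  qed
qed

text \<open>Without interleaving, \<open>c\<close> and \<open>d\<close> are both weakly between
  \<open>a\<close> and \<open>b\<close>, where \<open>chord_side a b\<close> is nonpositive, or both
  weakly outside, where it is nonnegative. As the pairs differ, it does not vanish at both.\<close>

lemma chords_disjoint:
  assumes "a < b" "c < d" "(a, b) \<noteq> (c, d)"
    and not_interleaved: "\<not> (a < c \<and> c < b \<and> b < d)" "\<not> (c < a \<and> a < d \<and> d < b)"
  shows "closed_segment (circle_point a) (circle_point b) \<inter> closed_segment (circle_point c) (circle_point d)
    \<subseteq> {circle_point c, circle_point d}"
proof
  fix z assume z: "z \<in> closed_segment (circle_point a) (circle_point b)
    \<inter> closed_segment (circle_point c) (circle_point d)"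
  then obtain u where u: "0 \<le> u" "u \<le> 1" "z = (1 - u) *\<^sub>R circle_point c + u *\<^sub>R circle_point d"
    by (auto simp: in_segment)
  let ?L = "\<lambda>t. chord_side a b (circle_point t)"
  have "(1 - u) * ?L c + u * ?L d = 0"
    using chord_side_segment[of z a b] z u(3) by (simp add: chord_side_convex)
  moreover have "0 \<le> ((c - a) * (c - b)) * ((d - a) * (d - b))"
  proof (cases "a \<le> c \<and> d \<le> b")
    case True
    with assms have "(c - a) * (c - b) \<le> 0" "(d - a) * (d - b) \<le> 0"
      by (auto simp: mult_le_0_iff)
    then show ?thesis by (rule mult_nonpos_nonpos)
  next
    case False
    with assms have "c \<le> a \<or> b \<le> c" "d \<le> a \<or> b \<le> d" by auto
    with assms have "0 \<le> (c - a) * (c - b)" "0 \<le> (d - a) * (d - b)"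
      by (auto simp: zero_le_mult_iff)
    then show ?thesis by (rule mult_nonneg_nonneg)
  qed
  then have "0 \<le> ?L c * ?L d"
    using sq_plus_one_pos[of c] sq_plus_one_pos[of d] by (simp add: chord_side_circle_point)
  moreover have "?L c \<noteq> 0 \<or> ?L d \<noteq> 0"
    using sq_plus_one_pos[of c] sq_plus_one_pos[of d] assms by (auto simp: chord_side_circle_point)
  ultimately have "u = 0 \<or> u = 1" using u nonneg_convex_zero by blast
  with u(3) show "z \<in> {circle_point c, circle_point d}" by auto
qed

text \<open>An edge is an unordered set; \<open>Min\<close> and \<open>Max\<close> choose the
  direction of the segment.\<close>

definition chord :: "nat set \<Rightarrow> real \<Rightarrow> complex" where
  "chord e = linepath (circle_point (Min e)) (circle_point (Max e))"

abbreviation vertex_point :: "nat \<Rightarrow> complex" where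
  "vertex_point v \<equiv> circle_point (real v)"

lemma chord_doubleton: "a < b \<Longrightarrow> chord {a, b} = linepath (vertex_point a) (vertex_point b)"
  by (simp add: chord_def)

lemma circle_drawing_chords:
  fixes G :: "nat ugraph"
  assumes "simple_graph G"
  shows "circle_drawing G vertex_point chord"
proof -
  have inj: "inj vertex_point" using inj_circle_point by (metis injD injI of_nat_eq_iff)
  have edge: "arc (chord e) \<and> {pathstart (chord e), pathfinish (chord e)} = vertex_point ` e \<and>
      path_image (chord e) \<inter> vertex_point ` verts G = vertex_point ` e \<and>
      path_image (chord e) - vertex_point ` e \<subseteq> ball (Complex 0 (1/2)) (1/2)"
    if e: "e \<in> edges G" for e
  proof -
    have "card e = 2" "e \<subseteq> verts G" using assms e by (auto simp: simple_graph_def)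
    then obtain a b where ab: "e = {a, b}" "a < b" by (metis card_2_iff doubleton_eq_iff linorder_neqE_nat)
    have "z \<in> ball (Complex 0 (1/2)) (1/2)"
      if "z \<in> open_segment (vertex_point a) (vertex_point b)" for z
      using dist_decreases_open_segment[OF that, of "Complex 0 (1/2)"]
        circle_point_sphere[of a] circle_point_sphere[of b] by auto
    moreover have "v = a \<or> v = b" if "vertex_point v \<in> closed_segment (vertex_point a) (vertex_point b)" for v
      using circle_point_on_chord[OF that] by simp
    then have "path_image (chord e) \<inter> vertex_point ` verts G \<subseteq> vertex_point ` e"
      by (auto simp: ab chord_doubleton)
    moreover have "vertex_point a \<noteq> vertex_point b" using injD[OF inj, of a b] ab(2) by auto
    ultimately show ?thesis
      using ab \<open>e \<subseteq> verts G\<close> by (auto simp: chord_doubleton open_segment_def)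
  qed
  have "inj_on vertex_point (verts G)" using inj inj_on_subset by blast
  then have "drawing G vertex_point chord" using edge by (simp add: drawing_def)
  moreover have "vertex_point ` verts G \<subseteq> sphere (Complex 0 (1/2)) (1/2)"
    using circle_point_sphere by blast
  ultimately show ?thesis
    unfolding circle_drawing_def using edge by (intro conjI exI[of _ "Complex 0 (1/2)"] exI[of _ "1/2"]) auto
qed

text \<open>Otherwise the segments share at most ends of the second, which are vertices and do not
  count as crossings.\<close>

lemma crosses_chords_interleaved:
  assumes "crosses G vertex_point chord {a, b} {c, d}" "a < b" "c < d" "c \<in> verts G" "d \<in> verts G"
  shows "a < c \<and> c < b \<and> b < d \<or> c < a \<and> a < d \<and> d < b"
proof (rule ccontr)
  assume "\<not> ?thesis"
  moreover have "(a, b) \<noteq> (c, d)" using assms(1) by (auto simp: crosses_def)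
  ultimately have "path_image (chord {a, b}) \<inter> path_image (chord {c, d}) \<subseteq> {vertex_point c, vertex_point d}"
    using chords_disjoint[of a b c d] assms(2,3) by (simp add: chord_doubleton)
  with assms show False unfolding crosses_def by blast
qed

section \<open>The ring of five copies of K_4\<close>

text \<open>The first six pairs form the K_4 on the hubs; the next eight are the diagonals of the
  outer copies, whose outer vertices are 1, 2, then 4, 5, then 7, 8, then 10, 11. Consecutive pairs
  and \<open>(0, 11)\<close> complete these copies.\<close>

definition inner_chords :: "(nat \<times> nat) set" where
  "inner_chords = {(0, 3), (3, 6), (6, 9), (0, 9), (0, 6), (3, 9), (0, 2), (1, 3), (3, 5), (4, 6),
    (6, 8), (7, 9), (9, 11), (0, 10), (0, 11)}"

definition chords :: "nat \<Rightarrow> (nat \<times> nat) set" where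
  "chords n = {(i, Suc i) | i. Suc i < n} \<union> {(0, n - 1)} \<union> inner_chords"

text \<open>The vertices from \<open>12\<close> on form a path from \<open>11\<close> to \<open>0\<close>; for \<open>n = 12\<close> the chord \<open>(0, 11)\<close>
  is the closing edge of the outer cycle.\<close>

definition K4_ring :: "nat \<Rightarrow> nat ugraph" where
  "K4_ring n = \<lparr>verts = {..<n}, edges = (\<lambda>(a, b). {a, b}) ` chords n\<rparr>"

lemma chords_less: "12 \<le> n \<Longrightarrow> (a, b) \<in> chords n \<Longrightarrow> a < b \<and> b < n"
  by (auto simp: chords_def inner_chords_def)

lemma simple_K4_ring: "12 \<le> n \<Longrightarrow> simple_graph (K4_ring n)"
  by (auto simp: simple_graph_def K4_ring_def dest!: chords_less)

lemma chord_in_K4_ring: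
  assumes "(a, b) \<in> chords n"
  shows "{a, b} \<in> edges (K4_ring n)"
  using imageI[OF assms, of "\<lambda>(a, b). {a, b}"] by (simp add: K4_ring_def)

lemma two_connected_K4_ring:
  assumes "12 \<le> n"
  shows "two_connected (K4_ring n)"
proof (rule two_connected_hamiltonian)
  show "verts (K4_ring n) = {..<n}" by (simp add: K4_ring_def)
qed (use assms in \<open>auto simp: simple_K4_ring chords_def intro!: chord_in_K4_ring\<close>)

text \<open>The two diagonals of each of the five copies of K_4. No chord occurs in two of the
  pairs, so each has at most one partner.\<close>

definition crossing_pairs :: "((nat \<times> nat) \<times> (nat \<times> nat)) set" where
  "crossing_pairs = {((0, 6), (3, 9)), ((0, 2), (1, 3)), ((3, 5), (4, 6)), ((6, 8), (7, 9)), ((0, 10), (9, 11))}"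

text \<open>This set does not depend on \<open>n\<close>, so one argument excludes a decomposition
  for all orders.\<close>

lemma K4_chords:
  "12 \<le> n \<Longrightarrow> inner_chords \<union> {(0, 1), (2, 3), (3, 4), (5, 6), (6, 7), (8, 9), (9, 10)} \<subseteq> chords n"
  by (auto simp: chords_def)

text \<open>No number lies strictly between \<open>i\<close> and \<open>Suc i\<close>, and no chord
  reaches beyond \<open>(0, n - 1)\<close>. So interleaved chords come from the finite list
  \<open>inner_chords\<close>, where evaluation decides.\<close>

lemma interleaved_chords:
  assumes n: "12 \<le> n" and "(a, b) \<in> chords n" "(c, d) \<in> chords n" "a < c" "c < b" "b < d"
  shows "((a, b), (c, d)) \<in> crossing_pairs"
proof -
  have "d < n" using chords_less[OF n assms(3)] by simp
  have "(a, b) \<in> inner_chords" "(c, d) \<in> inner_chords"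
    using assms \<open>d < n\<close> by (auto simp: chords_def)
  moreover have "\<forall>(a, b)\<in>inner_chords. \<forall>(c, d)\<in>inner_chords.
      a < c \<and> c < b \<and> b < d \<longrightarrow> ((a, b), (c, d)) \<in> crossing_pairs"
    by (simp add: inner_chords_def crossing_pairs_def)
  ultimately show ?thesis using assms(4-6) by fast
qed

lemma pseudo_outerplanar_K4_ring:
  assumes n: "12 \<le> n"
  shows "pseudo_outerplanar (K4_ring n)"
proof -
  let ?G = "K4_ring n"
  have simple: "simple_graph ?G" by (rule simple_K4_ring[OF n])
  have partner: "(p, q) \<in> crossing_pairs \<union> crossing_pairs\<inverse>"
    if "p \<in> chords n" "q \<in> chords n"
      "crosses ?G vertex_point chord (case p of (a, b) \<Rightarrow> {a, b}) (case q of (a, b) \<Rightarrow> {a, b})" for p q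
  proof -
    obtain a b c d where pq: "p = (a, b)" "q = (c, d)" by (cases p, cases q)
    with that chords_less[OF n] have "a < b" "c < d" "d < n" by auto
    then have "a < c \<and> c < b \<and> b < d \<or> c < a \<and> a < d \<and> d < b"
      using that(3) pq crosses_chords_interleaved[of ?G a b c d] by (simp add: K4_ring_def)
    then show ?thesis using interleaved_chords[OF n] that(1,2) pq by auto
  qed
  have partner_unique: "q = r"
    if "(p, q) \<in> crossing_pairs \<union> crossing_pairs\<inverse>" "(p, r) \<in> crossing_pairs \<union> crossing_pairs\<inverse>" for p q r
    using that by (auto simp: crossing_pairs_def)
  have "card {f \<in> edges ?G. crosses ?G vertex_point chord e f} \<le> 1" if "e \<in> edges ?G" for e
  proof -
    obtain p where p: "p \<in> chords n" "e = (case p of (a, b) \<Rightarrow> {a, b})"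
      using \<open>e \<in> edges ?G\<close> by (auto simp: K4_ring_def)
    have "edges ?G \<subseteq> Pow (verts ?G)" "finite (verts ?G)" using simple by (auto simp: simple_graph_def)
    then have "finite (edges ?G)" by (meson finite_Pow_iff finite_subset)
    moreover have "f = g" if fg: "f \<in> edges ?G" "crosses ?G vertex_point chord e f"
        "g \<in> edges ?G" "crosses ?G vertex_point chord e g" for f g
    proof -
      obtain q where q: "q \<in> chords n" "f = (case q of (a, b) \<Rightarrow> {a, b})"
        using fg(1) by (auto simp: K4_ring_def)
      obtain r where r: "r \<in> chords n" "g = (case r of (a, b) \<Rightarrow> {a, b})"
        using fg(3) by (auto simp: K4_ring_def)
      have "q = r" using partner_unique partner p q r fg by metis
      with q r show ?thesis by simp
    qed
    ultimately show ?thesis by (auto simp: card_le_Suc0_iff_eq)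
  qed
  then have "\<exists>pos \<gamma>. circle_drawing ?G pos \<gamma> \<and>
      (\<forall>e\<in>edges ?G. card {f \<in> edges ?G. crosses ?G pos \<gamma> e f} \<le> 1)"
    using circle_drawing_chords[OF simple] by blast
  then show ?thesis
    using simple is_block_two_connected[OF two_connected_K4_ring[OF n]]
    unfolding pseudo_outerplanar_def by blast
qed

section \<open>Impossibility of the decomposition\<close>

lemma K4_ring_not_decomposable:
  assumes n: "12 \<le> n" and H: "outerplanar H" and M: "matching M" and HM: "edges H \<union> M = edges (K4_ring n)"
  shows False
proof -
  let ?C = "inner_chords \<union> {(0, 1), (2, 3), (3, 4), (5, 6), (6, 7), (8, 9), (9, 10)}"
  have E: "{a, b} \<in> edges H \<union> M" if "(a, b) \<in> ?C \<or> (b, a) \<in> ?C" for a b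
  proof -
    have "(a, b) \<in> chords n \<or> (b, a) \<in> chords n" using that K4_chords[OF n] by blast
    then show ?thesis unfolding HM using chord_in_K4_ring by (metis insert_commute)
  qed
  \<comment> \<open>One application per side; \<open>u\<close> and \<open>w\<close> are the two hubs
    off that side.\<close>
  have D1: "{0, 1} \<in> M \<or> {0, 2} \<in> M \<or> {3, 1} \<in> M \<or> {3, 2} \<in> M"
    by (rule matched_side_edge[OF H M, where u = 6 and w = 9]; (rule E)?)
      (simp_all add: inner_chords_def)
  have D2: "{3, 4} \<in> M \<or> {3, 5} \<in> M \<or> {6, 4} \<in> M \<or> {6, 5} \<in> M"
    by (rule matched_side_edge[OF H M, where u = 0 and w = 9]; (rule E)?)
      (simp_all add: inner_chords_def)
  have D3: "{6, 7} \<in> M \<or> {6, 8} \<in> M \<or> {9, 7} \<in> M \<or> {9, 8} \<in> M"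
    by (rule matched_side_edge[OF H M, where u = 0 and w = 3]; (rule E)?)
      (simp_all add: inner_chords_def)
  have D4: "{9, 10} \<in> M \<or> {9, 11} \<in> M \<or> {0, 10} \<in> M \<or> {0, 11} \<in> M"
    by (rule matched_side_edge[OF H M, where u = 3 and w = 6]; (rule E)?)
      (simp_all add: inner_chords_def)
  have uniq: "{v, p} \<notin> M \<or> {v, q} \<notin> M" if "p \<noteq> q" for v p q
    using matching_mate_unique[OF M] that by blast
  \<comment> \<open>Common neighbours of the hubs 0 and 3 are the hubs 6 and 9 and an outer vertex
    \<open>y\<close> of their side; \<open>y\<close> will be the one of 1 and 2 that is not a mate
    of 0 or 3.\<close>
  have impossible: False
    if "{0, p} \<in> M" "{3, q} \<in> M" "y = 1 \<or> y = 2" "{p, q} \<inter> {6, 9, y} = {}" for p q y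
    by (rule unmatched_K23[OF H M that(1,2), of 6 9 y]; (rule E)?)
      (use that in \<open>auto simp: inner_chords_def\<close>)
  \<comment> \<open>Each hub serves at most one of its two sides, so the choice on the side from 0
    to 3 forces the others round the ring: every hub serves the following side, or every hub the
    preceding one. The instances of \<open>uniq\<close> name two neighbours and then their
    hub.\<close>
  have "({0, 1} \<in> M \<or> {0, 2} \<in> M) \<and> ({3, 4} \<in> M \<or> {3, 5} \<in> M) \<or>
      ({3, 1} \<in> M \<or> {3, 2} \<in> M) \<and> ({0, 10} \<in> M \<or> {0, 11} \<in> M)"
    using D1 D2 D3 D4
      uniq[of 1 10 0] uniq[of 1 11 0] uniq[of 2 10 0] uniq[of 2 11 0]
      uniq[of 1 4 3] uniq[of 1 5 3] uniq[of 2 4 3] uniq[of 2 5 3]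
      uniq[of 4 7 6] uniq[of 4 8 6] uniq[of 5 7 6] uniq[of 5 8 6]
      uniq[of 7 10 9] uniq[of 7 11 9] uniq[of 8 10 9] uniq[of 8 11 9]
    by simp argo
  then obtain p q where "{0, p} \<in> M" "{3, q} \<in> M"
      "p \<in> {1, 2} \<and> q \<in> {4, 5} \<or> q \<in> {1, 2} \<and> p \<in> {10, 11}" by auto
  then show False using impossible[of p q 1] impossible[of p q 2] by auto
qed

theorem theorem3p4:
  fixes n :: nat
  assumes "n \<ge> 12"
  shows "\<exists>G :: nat ugraph.
           simple_graph G \<and> card (verts G) = n \<and> two_connected G \<and> pseudo_outerplanar G \<and>
           \<not> (\<exists>(H :: nat ugraph) M.
                 outerplanar H \<and> matching M \<and>
                 edges H \<union> M = edges G \<and> edges H \<inter> M = {})"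
proof (intro exI[of _ "K4_ring n"] conjI notI)
  show "simple_graph (K4_ring n)" by (rule simple_K4_ring[OF assms])
  show "card (verts (K4_ring n)) = n" by (simp add: K4_ring_def)
  show "two_connected (K4_ring n)" by (rule two_connected_K4_ring[OF assms])
  show "pseudo_outerplanar (K4_ring n)" by (rule pseudo_outerplanar_K4_ring[OF assms])
  assume "\<exists>(H :: nat ugraph) M. outerplanar H \<and> matching M \<and>
    edges H \<union> M = edges (K4_ring n) \<and> edges H \<inter> M = {}"
  then show False using K4_ring_not_decomposable[OF assms] by metis
qed

end
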